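(* Let $\mathcal A=((A,[\,,\,]_A),(V,\rho),T)$ and $\mathcal B=((B,[\,,\,]_B),(M,\nu_M),S)$ be two relative Rota-Baxter Lie algebras over a field $k$. Let $0\to\mathcal B\xrightarrow{(\mathfrak i,i)}\hat{\mathcal A}\xrightarrow{(\mathfrak p,p)}\mathcal A\to0$ be a non-abelian extension of $\mathcal A$ by $\mathcal B$ with a section $(\mathfrak s,s)$ of $(\mathfrak p,p)$, where $\hat{\mathcal A}=((\hat A,[\,,\,]_{\hat A}),(\hat V,\hat\rho),\hat T)$, and let $(\omega,\varpi,\chi,\mu,\rho_B,\rho_M)$ be the corresponding non-abelian 2-cocycle induced by $(\mathfrak s,s)$. A pair $(\alpha,\beta)\in\mathrm{Aut}(\mathcal A)\times\mathrm{Aut}(\mathcal B)$, with $\alpha=(\alpha_1,\alpha_2)$ and $\beta=(\beta_1,\beta_2)$, is inducible if and only if there are linear maps $\zeta:A\to B$ and $\eta:V\to M$ such that for all $x,y\in A$, $a\in B$, $v\in V$, $m\in M$: $$\beta_1\omega(x,y)-\omega(\alpha_1(x),\alpha_1(y))=\rho_B(\alpha_1(x))\zeta(y)-\rho_B(\alpha_1(y))\zeta(x)-\zeta([x,y]_A)+[\zeta(x),\zeta(y)]_B,$$ $$\beta_1(\rho_B(x)a)-\rho_B(\alpha_1(x))\beta_1(a)=[\zeta(x),\beta_1(a)]_B,$$ $$\beta_2(\rho_M(x)m)-\rho_M(\alpha_1(x))\beta_2(m)=\nu_M(\zeta(x))\beta_2(m),$$ $$\beta_2(\mu(v)a)-\mu(\alpha_2(v))\beta_1(a)=-\nu_M(\beta_1(a))\eta(v),$$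 $$\beta_2\varpi(x,v)-\varpi(\alpha_1(x),\alpha_2(v))=\nu_M(\zeta(x))\eta(v)-\mu(\alpha_2(v))\zeta(x)+\rho_M(\alpha_1(x))\eta(v)-\eta(\rho(x)v),$$ $$\beta_1\chi(v)-\chi(\alpha_2(v))=S\eta(v)-\zeta T(v).$$
   Context: A relative Rota-Baxter Lie algebra is a triple $((A,[\,,\,]_A),(V,\rho),T)$ where $(A,[\,,\,]_A)$ is a Lie algebra, $\rho:A\to\mathfrak{gl}(V)$ is a representation of $A$ on the vector space $V$, and $T:V\to A$ is a linear map with $[T(u),T(v)]_A=T(\rho(T(u))v-\rho(T(v))u)$ for all $u,v\in V$. A homomorphism from $((A,[\,,\,]_A),(V,\rho),T)$ to $((A',[\,,\,]_{A'}),(V',\rho'),T')$ is a pair $(\varphi,\phi)$ with $\varphi:A\to A'$ a Lie algebra homomorphism and $\phi:V\to V'$ a linear map such that $T'\phi=\varphi T$ and $\phi(\rho(x)v)=\rho'(\varphi(x))\phi(v)$. $\mathrm{Aut}(\mathcal A)$ is the group of bijective homomorphisms $\mathcal A\to\mathcal A$. A non-abelian extension of $\mathcal A$ by $\mathcal B$ is a relative Rota-Baxter Lie algebra $\hat{\mathcal A}=((\hat A,[\,,\,]_{\hat A}),(\hat V,\hat\rho),\hat T)$ with homomorphisms $(\mathfrak i,i):\mathcal B\to\hat{\mathcal A}$ and $(\mathfrak p,p):\hat{\mathcal A}\to\mathcal A$ such that $0\to B\xrightarrow{\mathfrak i}\hat A\xrightarrow{\mathfrak p}A\to0$ and $0\to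 M\xrightarrow{i}\hat V\xrightarrow{p}V\to0$ are exact. $B$ and $M$ are identified with their images in $\hat A$ and $\hat V$. A section of $(\mathfrak p,p)$ is a pair of linear maps $\mathfrak s:A\to\hat A$, $s:V\to\hat V$ with $\mathfrak p\mathfrak s=\mathrm{id}_A$, $ps=\mathrm{id}_V$. The non-abelian 2-cocycle induced by $(\mathfrak s,s)$ is the sextuple given, for $x,y\in A$, $a\in B$, $v\in V$, $m\in M$, by $\omega(x,y)=[\mathfrak s(x),\mathfrak s(y)]_{\hat A}-\mathfrak s([x,y]_A)\in B$, $\varpi(x,v)=\hat\rho(\mathfrak s(x))s(v)-s(\rho(x)v)\in M$, $\chi(v)=\hat T(s(v))-\mathfrak s(T(v))\in B$, $\mu(v)a=-\hat\rho(a)s(v)\in M$, $\rho_B(x)a=[\mathfrak s(x),a]_{\hat A}\in B$, $\rho_M(x)m=\hat\rho(\mathfrak s(x))m\in M$. A pair $(\alpha,\beta)\in\mathrm{Aut}(\mathcal A)\times\mathrm{Aut}(\mathcal B)$ is inducible if there is $\gamma=(\gamma_1,\gamma_2)\in\mathrm{Aut}(\hat{\mathcal A})$ with $\gamma_1(B)\subseteq B$, $\gamma_2(M)\subseteq M$, $(\mathfrak p\gamma_1\mathfrak s,p\gamma_2s)=(\alpha_1,\alpha_2)$ and $(\gamma_1|_B,\gamma_2|_M)=(\beta_1,\beta_2)$. *)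

theory Defs
  imports Complex_Main
begin

text \<open>
  Vector spaces are whole types of class \<^class>\<open>ab_group_add\<close> with an explicit scalar
  multiplication by a field. No finite-dimensionality is assumed.
\<close>

locale lie_algebra = vector_space scale
  for scale :: "'k::field \<Rightarrow> 'a::ab_group_add \<Rightarrow> 'a" +
  fixes br :: "'a \<Rightarrow> 'a \<Rightarrow> 'a"
  assumes br_linear_left: "Vector_Spaces.linear scale scale (\<lambda>x. br x y)"
    and br_linear_right: "Vector_Spaces.linear scale scale (br x)"
    and br_alternating: "br x x = 0"
    and jacobi: "br x (br y z) + br y (br z x) + br z (br x y) = 0"

locale lie_representation =
  lie_algebra scale br + V: vector_space scaleV
  for scale :: "'k::field \<Rightarrow> 'a::ab_group_add \<Rightarrow> 'a"
    and br :: "'a \<Rightarrow> 'a \<Rightarrow> 'a"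
    and scaleV :: "'k \<Rightarrow> 'v::ab_group_add \<Rightarrow> 'v" +
  fixes rho :: "'a \<Rightarrow> 'v \<Rightarrow> 'v"
  assumes rho_linear_left: "Vector_Spaces.linear scale scaleV (\<lambda>x. rho x v)"
    and rho_linear_right: "Vector_Spaces.linear scaleV scaleV (rho x)"
    and rho_bracket: "rho (br x y) v = rho x (rho y v) - rho y (rho x v)"

text \<open>The data \<open>((A, [,]), (V, \<rho>), T)\<close>, together with the scalar multiplications of \<open>A\<close> and \<open>V\<close>.\<close>

record ('k, 'a, 'v) rrb_data =
  alg_scale :: "'k \<Rightarrow> 'a \<Rightarrow> 'a"
  bracket :: "'a \<Rightarrow> 'a \<Rightarrow> 'a"
  rep_scale :: "'k \<Rightarrow> 'v \<Rightarrow> 'v"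
  action :: "'a \<Rightarrow> 'v \<Rightarrow> 'v"
  rb_op :: "'v \<Rightarrow> 'a"

definition rel_rota_baxter_lie ::
    "('k::field, 'a::ab_group_add, 'v::ab_group_add) rrb_data \<Rightarrow> bool" where
  "rel_rota_baxter_lie R \<longleftrightarrow>
     lie_representation (alg_scale R) (bracket R) (rep_scale R) (action R) \<and>
     Vector_Spaces.linear (rep_scale R) (alg_scale R) (rb_op R) \<and>
     (\<forall>u v. bracket R (rb_op R u) (rb_op R v) =
        rb_op R (action R (rb_op R u) v - action R (rb_op R v) u))"

definition rrb_hom ::
    "('k::field, 'a::ab_group_add, 'v::ab_group_add) rrb_data \<Rightarrow>
     ('k, 'b::ab_group_add, 'w::ab_group_add) rrb_data \<Rightarrow>
     ('a \<Rightarrow> 'b) \<times> ('v \<Rightarrow> 'w) \<Rightarrow> bool" where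
  "rrb_hom R R' = (\<lambda>(f, g).
     Vector_Spaces.linear (alg_scale R) (alg_scale R') f \<and>
     (\<forall>x y. f (bracket R x y) = bracket R' (f x) (f y)) \<and>
     Vector_Spaces.linear (rep_scale R) (rep_scale R') g \<and>
     (\<forall>v. rb_op R' (g v) = f (rb_op R v)) \<and>
     (\<forall>x v. g (action R x v) = action R' (f x) (g v)))"

definition rrb_Aut ::
    "('k::field, 'a::ab_group_add, 'v::ab_group_add) rrb_data \<Rightarrow>
     (('a \<Rightarrow> 'a) \<times> ('v \<Rightarrow> 'v)) set" where
  "rrb_Aut R = {(f, g). rrb_hom R R (f, g) \<and> bij f \<and> bij g}"

text \<open>
  The identification of \<open>B\<close>, \<open>M\<close> with their images is kept explicit:
  \<open>B\<close> and \<open>M\<close> are types of their own, embedded by \<open>i1\<close> and \<open>i2\<close>.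
\<close>

definition nonabelian_extension ::
    "('k::field, 'a::ab_group_add, 'v::ab_group_add) rrb_data \<Rightarrow>
     ('k, 'b::ab_group_add, 'm::ab_group_add) rrb_data \<Rightarrow>
     ('k, 'e::ab_group_add, 'w::ab_group_add) rrb_data \<Rightarrow>
     ('b \<Rightarrow> 'e) \<times> ('m \<Rightarrow> 'w) \<Rightarrow> ('e \<Rightarrow> 'a) \<times> ('w \<Rightarrow> 'v) \<Rightarrow> bool" where
  "nonabelian_extension A B E = (\<lambda>(i1, i2) (p1, p2).
     rel_rota_baxter_lie A \<and> rel_rota_baxter_lie B \<and> rel_rota_baxter_lie E \<and>
     rrb_hom B E (i1, i2) \<and> rrb_hom E A (p1, p2) \<and>
     inj i1 \<and> range i1 = {e. p1 e = 0} \<and> surj p1 \<and>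
     inj i2 \<and> range i2 = {w. p2 w = 0} \<and> surj p2)"

definition is_section ::
    "('k::field, 'a::ab_group_add, 'v::ab_group_add) rrb_data \<Rightarrow>
     ('k, 'e::ab_group_add, 'w::ab_group_add) rrb_data \<Rightarrow>
     ('e \<Rightarrow> 'a) \<times> ('w \<Rightarrow> 'v) \<Rightarrow> ('a \<Rightarrow> 'e) \<times> ('v \<Rightarrow> 'w) \<Rightarrow> bool" where
  "is_section A E = (\<lambda>(p1, p2) (s1, s2).
     Vector_Spaces.linear (alg_scale A) (alg_scale E) s1 \<and>
     Vector_Spaces.linear (rep_scale A) (rep_scale E) s2 \<and>
     p1 \<circ> s1 = id \<and> p2 \<circ> s2 = id)"

text \<open>
  The sextuple \<open>(\<omega>, \<varpi>, \<chi>, \<mu>, \<rho>\<^sub>B, \<rho>\<^sub>M)\<close>. Each right-hand side lies in the image of the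
  embedding \<open>i1\<close> or \<open>i2\<close> (lemma \<open>induced_cocycle_embed\<close>), so the inverse embeddings only turn it
  into an element of \<open>B\<close> or \<open>M\<close>.
\<close>

definition induced_cocycle ::
    "('k::field, 'a::ab_group_add, 'v::ab_group_add) rrb_data \<Rightarrow>
     ('k, 'e::ab_group_add, 'w::ab_group_add) rrb_data \<Rightarrow>
     ('b::ab_group_add \<Rightarrow> 'e) \<times> ('m::ab_group_add \<Rightarrow> 'w) \<Rightarrow>
     ('a \<Rightarrow> 'e) \<times> ('v \<Rightarrow> 'w) \<Rightarrow>
     ('a \<Rightarrow> 'a \<Rightarrow> 'b) \<times> ('a \<Rightarrow> 'v \<Rightarrow> 'm) \<times> ('v \<Rightarrow> 'b) \<times>
     ('v \<Rightarrow> 'b \<Rightarrow> 'm) \<times> ('a \<Rightarrow> 'b \<Rightarrow> 'b) \<times> ('a \<Rightarrow> 'm \<Rightarrow> 'm)" where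
  "induced_cocycle A E = (\<lambda>(i1, i2) (s1, s2).
     (\<lambda>x y. inv i1 (bracket E (s1 x) (s1 y) - s1 (bracket A x y)),
      \<lambda>x v. inv i2 (action E (s1 x) (s2 v) - s2 (action A x v)),
      \<lambda>v. inv i1 (rb_op E (s2 v) - s1 (rb_op A v)),
      \<lambda>v a. inv i2 (- action E (i1 a) (s2 v)),
      \<lambda>x a. inv i1 (bracket E (s1 x) (i1 a)),
      \<lambda>x m. inv i2 (action E (s1 x) (i2 m))))"

lemma induced_cocycle_embed:
  assumes ext: "nonabelian_extension A B E (i1, i2) (p1, p2)"
    and sec: "is_section A E (p1, p2) (s1, s2)"
    and coc: "(\<omega>, \<omega>', \<chi>, \<mu>, \<rho>B, \<rho>M) = induced_cocycle A E (i1, i2) (s1, s2)"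
  shows "i1 (\<omega> x y) = bracket E (s1 x) (s1 y) - s1 (bracket A x y)"
    and "i2 (\<omega>' x v) = action E (s1 x) (s2 v) - s2 (action A x v)"
    and "i1 (\<chi> v) = rb_op E (s2 v) - s1 (rb_op A v)"
    and "i2 (\<mu> v a) = - action E (i1 a) (s2 v)"
    and "i1 (\<rho>B x a) = bracket E (s1 x) (i1 a)"
    and "i2 (\<rho>M x m) = action E (s1 x) (i2 m)"
proof -
  have A: "lie_representation (alg_scale A) (bracket A) (rep_scale A) (action A)"
    and p: "Vector_Spaces.linear (alg_scale E) (alg_scale A) p1"
      "Vector_Spaces.linear (rep_scale E) (rep_scale A) p2"
      "\<And>x y. p1 (bracket E x y) = bracket A (p1 x) (p1 y)"
      "\<And>v. rb_op A (p2 v) = p1 (rb_op E v)"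
      "\<And>x v. p2 (action E x v) = action A (p1 x) (p2 v)"
    and r: "range i1 = {e. p1 e = 0}" "range i2 = {w. p2 w = 0}"
    using ext by (auto simp: nonabelian_extension_def rrb_hom_def rel_rota_baxter_lie_def)
  interpret A: lie_representation "alg_scale A" "bracket A" "rep_scale A" "action A" by (rule A)
  interpret p1: Vector_Spaces.linear "alg_scale E" "alg_scale A" p1 by (rule p)
  interpret p2: Vector_Spaces.linear "rep_scale E" "rep_scale A" p2 by (rule p)
  have s: "p1 (s1 x) = x" "p2 (s2 v) = v" for x v
    using sec by (auto simp: is_section_def fun_eq_iff)
  have i0: "p1 (i1 a) = 0" "p2 (i2 m) = 0" for a m
    using r by auto
  have z: "bracket A x 0 = 0" "action A x 0 = 0" "action A 0 v = 0" for x v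
    using module_hom.zero[OF Vector_Spaces.linear.axioms(3)[OF A.br_linear_right[of x]]]
      module_hom.zero[OF Vector_Spaces.linear.axioms(3)[OF A.rho_linear_right[of x]]]
      module_hom.zero[OF Vector_Spaces.linear.axioms(3)[OF A.rho_linear_left[of v]]] by auto
  have e1: "i1 (inv i1 e) = e" if "p1 e = 0" for e
    by (rule f_inv_into_f) (use that r in auto)
  have e2: "i2 (inv i2 w) = w" if "p2 w = 0" for w
    by (rule f_inv_into_f) (use that r in auto)
  note c = coc[unfolded induced_cocycle_def prod.case prod.inject]
  show "i1 (\<omega> x y) = bracket E (s1 x) (s1 y) - s1 (bracket A x y)"
    using c by (simp add: e1 p1.diff p(3) s)
  show "i2 (\<omega>' x v) = action E (s1 x) (s2 v) - s2 (action A x v)"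
    using c by (simp add: e2 p2.diff p(5) s)
  show "i1 (\<chi> v) = rb_op E (s2 v) - s1 (rb_op A v)"
    using c by (simp add: e1 p1.diff p(4)[symmetric] s)
  show "i2 (\<mu> v a) = - action E (i1 a) (s2 v)"
    using c by (simp add: e2 p2.neg p(5) s i0 z)
  show "i1 (\<rho>B x a) = bracket E (s1 x) (i1 a)"
    using c by (simp add: e1 p(3) i0 z)
  show "i2 (\<rho>M x m) = action E (s1 x) (i2 m)"
    using c by (simp add: e2 p(5) i0 z)
qed

text \<open>
  Through the embeddings, \<open>\<gamma>1|\<^sub>B = \<beta>1\<close> reads \<open>\<gamma>1 \<circ> i1 = i1 \<circ> \<beta>1\<close>, and likewise for \<open>\<gamma>2\<close>.
\<close>

definition inducible ::
    "('k::field, 'e::ab_group_add, 'w::ab_group_add) rrb_data \<Rightarrow>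
     ('b \<Rightarrow> 'e) \<times> ('m \<Rightarrow> 'w) \<Rightarrow> ('e \<Rightarrow> 'a) \<times> ('w \<Rightarrow> 'v) \<Rightarrow>
     ('a \<Rightarrow> 'e) \<times> ('v \<Rightarrow> 'w) \<Rightarrow>
     ('a \<Rightarrow> 'a) \<times> ('v \<Rightarrow> 'v) \<Rightarrow> ('b \<Rightarrow> 'b) \<times> ('m \<Rightarrow> 'm) \<Rightarrow> bool" where
  "inducible E = (\<lambda>(i1, i2) (p1, p2) (s1, s2) (\<alpha>1, \<alpha>2) (\<beta>1, \<beta>2).
     \<exists>\<gamma>1 \<gamma>2. (\<gamma>1, \<gamma>2) \<in> rrb_Aut E \<and>
       \<gamma>1 ` range i1 \<subseteq> range i1 \<and> \<gamma>2 ` range i2 \<subseteq> range i2 \<and>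
       p1 \<circ> \<gamma>1 \<circ> s1 = \<alpha>1 \<and> p2 \<circ> \<gamma>2 \<circ> s2 = \<alpha>2 \<and>
       \<gamma>1 \<circ> i1 = i1 \<circ> \<beta>1 \<and> \<gamma>2 \<circ> i2 = i2 \<circ> \<beta>2)"

end

theory Submission
  imports Defs
begin

text \<open>
  A section splits \<open>E\<close> additively, so that every element is uniquely \<open>s x + i a\<close>. A linear map of
  \<open>E\<close> that induces \<open>\<alpha>\<close> on the quotient and \<open>\<beta>\<close> on the kernel must have the form
  \<open>s x + i a \<mapsto> s (\<alpha> x) + i (\<zeta> x + \<beta> a)\<close> for some linear \<open>\<zeta>\<close>, and every map of this form is
  bijective. In these coordinates the structure maps of the extension are given by the cocycle,
  and comparing the kernel components turns the homomorphism equations into the six identities.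
\<close>

section \<open>Split short exact sequences of vector spaces\<close>

locale linear_splitting =
  i: Vector_Spaces.linear sB sE i + p: Vector_Spaces.linear sE sA p +
  s: Vector_Spaces.linear sA sE s
  for sA :: "'k::field \<Rightarrow> 'a::ab_group_add \<Rightarrow> 'a"
    and sB :: "'k \<Rightarrow> 'b::ab_group_add \<Rightarrow> 'b"
    and sE :: "'k \<Rightarrow> 'e::ab_group_add \<Rightarrow> 'e"
    and i :: "'b \<Rightarrow> 'e" and p :: "'e \<Rightarrow> 'a" and s :: "'a \<Rightarrow> 'e" +
  assumes inj_i: "inj i" and range_i: "range i = {e. p e = 0}"
    and p_s [simp]: "p (s x) = x"
begin

text \<open>The retraction onto the kernel that belongs to the section: \<open>e - s (p e)\<close>
  is killed by \<open>p\<close>, so it has a preimage under \<open>i\<close>.\<close>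

definition ret :: "'e \<Rightarrow> 'b" where
  "ret e = inv i (e - s (p e))"

lemma i_eq_iff [simp]: "i a = i b \<longleftrightarrow> a = b"
  using inj_i by (auto dest: injD)

lemma p_i [simp]: "p (i a) = 0"
  using range_i by auto

lemma i_inv: "p e = 0 \<Longrightarrow> i (inv i e) = e"
  using range_i by (intro f_inv_into_f) auto

lemma i_ret: "i (ret e) = e - s (p e)"
  unfolding ret_def by (rule i_inv) (simp add: p.diff)

lemma split: "e = s (p e) + i (ret e)"
  by (simp add: i_ret)

lemma ex_split: "\<exists>x a. e = s x + i a"
  using split by blast

lemma p_split: "p (s x + i a) = x"
  by (simp add: p.add)

lemma ret_split: "ret (s x + i a) = a"
  by (simp add: ret_def p_split inv_f_f[OF inj_i])

lemma split_eq_iff [simp]: "s x + i a = s y + i b \<longleftrightarrow> x = y \<and> a = b"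
  by (metis p_split ret_split)

text \<open>As \<open>i\<close> is injective and linear, both laws can be tested after applying
  \<open>i\<close>, where \<open>ret e\<close> becomes \<open>e - s (p e)\<close>, visibly linear in
  \<open>e\<close>.\<close>

lemma linear_ret: "Vector_Spaces.linear sE sB ret"
proof -
  have "ret (x + y) = ret x + ret y" for x y
    unfolding i_eq_iff[symmetric] by (simp add: i.add i_ret p.add s.add)
  moreover have "ret (sE c x) = sB c (ret x)" for c x
    unfolding i_eq_iff[symmetric]
    by (simp add: i.scale i_ret p.scale s.scale i.vs2.scale_right_diff_distrib)
  ultimately show ?thesis
    by (simp add: Vector_Spaces.linear_iff i.vs1.vector_space_axioms i.vs2.vector_space_axioms)
qed

text \<open>In the coordinates \<open>(x, a)\<close> this is the triangular block matrix with
  diagonal \<open>\<alpha>\<close>, \<open>\<beta>\<close> and off-diagonal entry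
  \<open>\<zeta>\<close>.\<close>

definition lift :: "('a \<Rightarrow> 'a) \<Rightarrow> ('b \<Rightarrow> 'b) \<Rightarrow> ('a \<Rightarrow> 'b) \<Rightarrow> 'e \<Rightarrow> 'e" where
  "lift \<alpha> \<beta> \<zeta> e = s (\<alpha> (p e)) + i (\<zeta> (p e) + \<beta> (ret e))"

lemma lift_split [simp]: "lift \<alpha> \<beta> \<zeta> (s x + i a) = s (\<alpha> x) + i (\<zeta> x + \<beta> a)"
  by (simp add: lift_def p_split ret_split)

lemma p_lift: "p (lift \<alpha> \<beta> \<zeta> e) = \<alpha> (p e)"
  by (simp add: lift_def p_split)

lemma lift_i:
  assumes "Vector_Spaces.linear sA sA \<alpha>" and "Vector_Spaces.linear sA sB \<zeta>"
  shows "lift \<alpha> \<beta> \<zeta> (i a) = i (\<beta> a)"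
proof -
  interpret a: Vector_Spaces.linear sA sA \<alpha> by (rule assms)
  interpret z: Vector_Spaces.linear sA sB \<zeta> by (rule assms)
  show ?thesis using lift_split[of \<alpha> \<beta> \<zeta> 0 a] by (simp add: s.zero a.zero z.zero)
qed

lemma linear_lift:
  assumes "Vector_Spaces.linear sA sA \<alpha>" and "Vector_Spaces.linear sB sB \<beta>"
    and "Vector_Spaces.linear sA sB \<zeta>"
  shows "Vector_Spaces.linear sE sE (lift \<alpha> \<beta> \<zeta>)"
proof -
  interpret a: Vector_Spaces.linear sA sA \<alpha> by (rule assms)
  interpret b: Vector_Spaces.linear sB sB \<beta> by (rule assms)
  interpret z: Vector_Spaces.linear sA sB \<zeta> by (rule assms)
  interpret r: Vector_Spaces.linear sE sB ret by (rule linear_ret)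
  show ?thesis
    unfolding Vector_Spaces.linear_iff lift_def
    by (simp add: i.vs2.vector_space_axioms p.add p.scale r.add r.scale a.add a.scale b.add b.scale
        z.add z.scale i.add i.scale s.add s.scale i.vs2.scale_right_distrib)
qed

text \<open>A triangular system with invertible diagonal: \<open>\<alpha>\<close> determines the
  quotient coordinate, and after the shift by \<open>\<zeta>\<close> is removed,
  \<open>\<beta>\<close> determines the kernel coordinate.\<close>

lemma bij_lift:
  assumes "bij \<alpha>" and "bij \<beta>"
  shows "bij (lift \<alpha> \<beta> \<zeta>)"
proof (rule bijI)
  show "inj (lift \<alpha> \<beta> \<zeta>)"
  proof (rule injI)
    fix e f assume eq: "lift \<alpha> \<beta> \<zeta> e = lift \<alpha> \<beta> \<zeta> f"
    obtain x a y b where "e = s x + i a" "f = s y + i b"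
      using ex_split by metis
    with eq show "e = f"
      using assms by (auto simp: bij_def inj_eq)
  qed
  show "surj (lift \<alpha> \<beta> \<zeta>)"
  proof (rule surjI)
    fix e
    \<comment> \<open>Back substitution: the quotient coordinate of the preimage is found first,
      since \<open>\<zeta> ?x\<close> enters the equation for the kernel coordinate.\<close>
    let ?x = "inv \<alpha> (p e)"
    show "lift \<alpha> \<beta> \<zeta> (s ?x + i (inv \<beta> (ret e - \<zeta> ?x))) = e"
      using assms split[of e] by (simp add: bij_def surj_f_inv_f)
  qed
qed

lemma ex_lift:
  assumes g: "Vector_Spaces.linear sE sE \<gamma>"
    and pgs: "p \<circ> \<gamma> \<circ> s = \<alpha>" and gi: "\<gamma> \<circ> i = i \<circ> \<beta>"
  shows "\<exists>\<zeta>. Vector_Spaces.linear sA sB \<zeta> \<and> \<gamma> = lift \<alpha> \<beta> \<zeta>"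
proof -
  interpret g: Vector_Spaces.linear sE sE \<gamma> by (rule g)
  interpret r: Vector_Spaces.linear sE sB ret by (rule linear_ret)
  \<comment> \<open>The off-diagonal entry is the kernel component of \<open>\<gamma>\<close> on the
    section; the quotient component there is \<open>\<alpha>\<close> by \<open>pgs\<close>, and the
    values on the kernel are given by \<open>gi\<close>.\<close>
  define \<zeta> where "\<zeta> = (\<lambda>x. ret (\<gamma> (s x)))"
  have "Vector_Spaces.linear sA sB \<zeta>"
    by (simp add: Vector_Spaces.linear_iff \<zeta>_def p.vs2.vector_space_axioms i.vs1.vector_space_axioms
        s.add s.scale g.add g.scale r.add r.scale)
  moreover have "\<gamma> e = lift \<alpha> \<beta> \<zeta> e" for e
  proof -
    have "\<gamma> e = \<gamma> (s (p e)) + \<gamma> (i (ret e))"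
      by (metis split g.add)
    also have "\<gamma> (s (p e)) = s (\<alpha> (p e)) + i (\<zeta> (p e))"
      using split[of "\<gamma> (s (p e))"] pgs by (auto simp: \<zeta>_def)
    also have "\<gamma> (i (ret e)) = i (\<beta> (ret e))"
      using gi by (metis comp_apply)
    finally show ?thesis
      by (simp add: lift_def i.add add.assoc)
  qed
  ultimately show ?thesis by blast
qed

end

section \<open>Bilinearity and antisymmetry of the structure maps\<close>

context lie_algebra
begin

sublocale br_left: Vector_Spaces.linear scale scale "\<lambda>x. br x y" for y
  by (rule br_linear_left)

sublocale br_right: Vector_Spaces.linear scale scale "br x" for x
  by (rule br_linear_right)

text \<open>Polarization: expand \<open>br z z = 0\<close> at \<open>z = x + y\<close>. This works
  in every characteristic.\<close>

lemma br_antisym: "br x y = - br y x"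
proof -
  have "br x y + br y x = br (x + y) (x + y)"
    unfolding br_left.add br_right.add by (simp add: br_alternating)
  then show ?thesis
    by (simp add: br_alternating eq_neg_iff_add_eq_0)
qed

end

context lie_representation
begin

sublocale rho_left: Vector_Spaces.linear scale scaleV "\<lambda>x. rho x v" for v
  by (rule rho_linear_left)

sublocale rho_right: Vector_Spaces.linear scaleV scaleV "rho x" for x
  by (rule rho_linear_right)

end

section \<open>The structure maps of the extension in coordinates\<close>

locale rrb_split_extension =
  fixes A :: "('k::field, 'a::ab_group_add, 'v::ab_group_add) rrb_data"
    and B :: "('k, 'b::ab_group_add, 'm::ab_group_add) rrb_data"
    and E :: "('k, 'e::ab_group_add, 'w::ab_group_add) rrb_data"
    and i1 :: "'b \<Rightarrow> 'e" and i2 :: "'m \<Rightarrow> 'w"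
    and p1 :: "'e \<Rightarrow> 'a" and p2 :: "'w \<Rightarrow> 'v"
    and s1 :: "'a \<Rightarrow> 'e" and s2 :: "'v \<Rightarrow> 'w"
    and \<omega> :: "'a \<Rightarrow> 'a \<Rightarrow> 'b" and \<omega>' :: "'a \<Rightarrow> 'v \<Rightarrow> 'm" and \<chi> :: "'v \<Rightarrow> 'b"
    and \<mu> :: "'v \<Rightarrow> 'b \<Rightarrow> 'm" and \<rho>B :: "'a \<Rightarrow> 'b \<Rightarrow> 'b" and \<rho>M :: "'a \<Rightarrow> 'm \<Rightarrow> 'm"
  assumes extension: "nonabelian_extension A B E (i1, i2) (p1, p2)"
    and "section": "is_section A E (p1, p2) (s1, s2)"
    and cocycle: "(\<omega>, \<omega>', \<chi>, \<mu>, \<rho>B, \<rho>M) = induced_cocycle A E (i1, i2) (s1, s2)"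
begin

lemma hom_i: "rrb_hom B E (i1, i2)"
  using extension by (simp add: nonabelian_extension_def)

lemma i_hom:
  "i1 (bracket B a b) = bracket E (i1 a) (i1 b)"
  "i2 (action B a m) = action E (i1 a) (i2 m)"
  "i1 (rb_op B m) = rb_op E (i2 m)"
  using hom_i by (auto simp: rrb_hom_def)

lemma rrb_E: "rel_rota_baxter_lie E" and rrb_B: "rel_rota_baxter_lie B"
  using extension by (auto simp: nonabelian_extension_def)

sublocale alg: linear_splitting "alg_scale A" "alg_scale B" "alg_scale E" i1 p1 s1
  using extension "section"
  by (auto simp: linear_splitting_def linear_splitting_axioms_def nonabelian_extension_def
      rrb_hom_def is_section_def fun_eq_iff)

sublocale rep: linear_splitting "rep_scale A" "rep_scale B" "rep_scale E" i2 p2 s2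
  using extension "section"
  by (auto simp: linear_splitting_def linear_splitting_axioms_def nonabelian_extension_def
      rrb_hom_def is_section_def fun_eq_iff)

sublocale E: lie_representation "alg_scale E" "bracket E" "rep_scale E" "action E"
  using rrb_E by (simp add: rel_rota_baxter_lie_def)

sublocale B: lie_representation "alg_scale B" "bracket B" "rep_scale B" "action B"
  using rrb_B by (simp add: rel_rota_baxter_lie_def)

sublocale TE: Vector_Spaces.linear "rep_scale E" "alg_scale E" "rb_op E"
  using rrb_E by (simp add: rel_rota_baxter_lie_def)

sublocale TB: Vector_Spaces.linear "rep_scale B" "alg_scale B" "rb_op B"
  using rrb_B by (simp add: rel_rota_baxter_lie_def)

lemmas embed = induced_cocycle_embed[OF extension "section" cocycle]

lemma bracket_split:
  "bracket E (s1 x + i1 a) (s1 y + i1 b) =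
    s1 (bracket A x y) + i1 (\<omega> x y + \<rho>B x b - \<rho>B y a + bracket B a b)"
  \<comment> \<open>\<open>\<rho>B\<close> is defined with the section in the first slot, so the
    mixed term with the kernel element first has to be flipped; this is the source of the minus sign
    before \<open>\<rho>B y a\<close>.\<close>
  using E.br_antisym[of "i1 a" "s1 y"]
  by (simp add: embed i_hom alg.i.add alg.i.diff E.br_left.add E.br_right.add algebra_simps)

text \<open>Expansion by bilinearity. The sign of the \<open>\<mu>\<close> term undoes the minus
  sign in the definition of \<open>\<mu>\<close>.\<close>

lemma action_split:
  "action E (s1 x + i1 a) (s2 v + i2 m) =
    s2 (action A x v) + i2 (\<omega>' x v + \<rho>M x m - \<mu> v a + action B a m)"
  by (simp add: embed i_hom rep.i.add rep.i.diff E.rho_left.add E.rho_right.add algebra_simps)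

lemma rb_op_split:
  "rb_op E (s2 v + i2 m) = s1 (rb_op A v) + i1 (\<chi> v + rb_op B m)"
  by (simp add: embed i_hom alg.i.add TE.add algebra_simps)

text \<open>Here and for \<open>\<rho>M\<close> and \<open>\<mu>\<close>, injectivity of the
  embedding moves the claim into the extension, where it is additivity of the bracket or the
  action.\<close>

lemma \<rho>B_add: "\<rho>B x (a + b) = \<rho>B x a + \<rho>B x b"
  unfolding alg.i_eq_iff[symmetric] by (simp add: embed alg.i.add E.br_right.add)

lemma \<rho>M_add: "\<rho>M x (m + n) = \<rho>M x m + \<rho>M x n"
  unfolding rep.i_eq_iff[symmetric] by (simp add: embed rep.i.add E.rho_right.add)

lemma \<mu>_add: "\<mu> v (a + b) = \<mu> v a + \<mu> v b"
  unfolding rep.i_eq_iff[symmetric]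
  by (simp add: embed alg.i.add rep.i.add E.rho_left.add)

lemma \<rho>B_zero: "\<rho>B x 0 = 0"
  using \<rho>B_add[of x 0 0] by simp

lemma \<rho>M_zero: "\<rho>M x 0 = 0"
  using \<rho>M_add[of x 0 0] by simp

lemma \<mu>_zero: "\<mu> v 0 = 0"
  using \<mu>_add[of v 0 0] by simp

section \<open>Inducing automorphisms as triangular lifts\<close>

context
  fixes \<alpha>1 :: "'a \<Rightarrow> 'a" and \<alpha>2 :: "'v \<Rightarrow> 'v" and \<beta>1 :: "'b \<Rightarrow> 'b" and \<beta>2 :: "'m \<Rightarrow> 'm"
  assumes \<alpha>: "(\<alpha>1, \<alpha>2) \<in> rrb_Aut A" and \<beta>: "(\<beta>1, \<beta>2) \<in> rrb_Aut B"
begin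

lemma \<alpha>_linear:
  "Vector_Spaces.linear (alg_scale A) (alg_scale A) \<alpha>1"
  "Vector_Spaces.linear (rep_scale A) (rep_scale A) \<alpha>2"
  and \<beta>_linear:
  "Vector_Spaces.linear (alg_scale B) (alg_scale B) \<beta>1"
  "Vector_Spaces.linear (rep_scale B) (rep_scale B) \<beta>2"
  and \<alpha>_bij: "bij \<alpha>1" "bij \<alpha>2" and \<beta>_bij: "bij \<beta>1" "bij \<beta>2"
  using \<alpha> \<beta> by (auto simp: rrb_Aut_def rrb_hom_def)

lemma \<alpha>_hom:
  "\<alpha>1 (bracket A x y) = bracket A (\<alpha>1 x) (\<alpha>1 y)"
  "\<alpha>2 (action A x v) = action A (\<alpha>1 x) (\<alpha>2 v)"
  "\<alpha>1 (rb_op A v) = rb_op A (\<alpha>2 v)"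
  using \<alpha> by (auto simp: rrb_Aut_def rrb_hom_def)

lemma \<beta>_hom:
  "\<beta>1 (bracket B a b) = bracket B (\<beta>1 a) (\<beta>1 b)"
  "\<beta>2 (action B a m) = action B (\<beta>1 a) (\<beta>2 m)"
  "\<beta>1 (rb_op B m) = rb_op B (\<beta>2 m)"
  using \<beta> by (auto simp: rrb_Aut_def rrb_hom_def)

text \<open>By \<open>ex_lift\<close> the compatible linear maps all are lifts. Conversely a lift is
  bijective, preserves the kernels and induces the given pair, so being a homomorphism is the one
  condition left on \<open>\<zeta>\<close> and \<open>\<eta>\<close>.\<close>

lemma inducible_iff_lift:
  "inducible E (i1, i2) (p1, p2) (s1, s2) (\<alpha>1, \<alpha>2) (\<beta>1, \<beta>2) \<longleftrightarrow>
    (\<exists>\<zeta> \<eta>. Vector_Spaces.linear (alg_scale A) (alg_scale B) \<zeta> \<and>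
      Vector_Spaces.linear (rep_scale A) (rep_scale B) \<eta> \<and>
      rrb_hom E E (alg.lift \<alpha>1 \<beta>1 \<zeta>, rep.lift \<alpha>2 \<beta>2 \<eta>))"
proof
  assume "inducible E (i1, i2) (p1, p2) (s1, s2) (\<alpha>1, \<alpha>2) (\<beta>1, \<beta>2)"
  then obtain \<gamma>1 \<gamma>2 where hom: "rrb_hom E E (\<gamma>1, \<gamma>2)"
    and p: "p1 \<circ> \<gamma>1 \<circ> s1 = \<alpha>1" "p2 \<circ> \<gamma>2 \<circ> s2 = \<alpha>2"
    and i: "\<gamma>1 \<circ> i1 = i1 \<circ> \<beta>1" "\<gamma>2 \<circ> i2 = i2 \<circ> \<beta>2"
    by (auto simp: inducible_def rrb_Aut_def)
  have "Vector_Spaces.linear (alg_scale E) (alg_scale E) \<gamma>1"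
    "Vector_Spaces.linear (rep_scale E) (rep_scale E) \<gamma>2"
    using hom by (auto simp: rrb_hom_def)
  with alg.ex_lift[OF _ p(1) i(1)] rep.ex_lift[OF _ p(2) i(2)] hom
  show "\<exists>\<zeta> \<eta>. Vector_Spaces.linear (alg_scale A) (alg_scale B) \<zeta> \<and>
      Vector_Spaces.linear (rep_scale A) (rep_scale B) \<eta> \<and>
      rrb_hom E E (alg.lift \<alpha>1 \<beta>1 \<zeta>, rep.lift \<alpha>2 \<beta>2 \<eta>)"
    by blast
next
  assume "\<exists>\<zeta> \<eta>. Vector_Spaces.linear (alg_scale A) (alg_scale B) \<zeta> \<and>
      Vector_Spaces.linear (rep_scale A) (rep_scale B) \<eta> \<and>
      rrb_hom E E (alg.lift \<alpha>1 \<beta>1 \<zeta>, rep.lift \<alpha>2 \<beta>2 \<eta>)"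
  then obtain \<zeta> \<eta> where lin: "Vector_Spaces.linear (alg_scale A) (alg_scale B) \<zeta>"
      "Vector_Spaces.linear (rep_scale A) (rep_scale B) \<eta>"
    and hom: "rrb_hom E E (alg.lift \<alpha>1 \<beta>1 \<zeta>, rep.lift \<alpha>2 \<beta>2 \<eta>)"
    by blast
  show "inducible E (i1, i2) (p1, p2) (s1, s2) (\<alpha>1, \<alpha>2) (\<beta>1, \<beta>2)"
    unfolding inducible_def prod.case
  proof (intro exI conjI)
    show "(alg.lift \<alpha>1 \<beta>1 \<zeta>, rep.lift \<alpha>2 \<beta>2 \<eta>) \<in> rrb_Aut E"
      using hom alg.bij_lift rep.bij_lift \<alpha>_bij \<beta>_bij by (simp add: rrb_Aut_def)
  qed (auto simp: fun_eq_iff alg.p_lift rep.p_lift alg.lift_i[OF \<alpha>_linear(1) lin(1)]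
      rep.lift_i[OF \<alpha>_linear(2) lin(2)])
qed

section \<open>The homomorphism equations in coordinates\<close>

context
  fixes \<zeta> :: "'a \<Rightarrow> 'b" and \<eta> :: "'v \<Rightarrow> 'm"
  assumes \<zeta>: "Vector_Spaces.linear (alg_scale A) (alg_scale B) \<zeta>"
    and \<eta>: "Vector_Spaces.linear (rep_scale A) (rep_scale B) \<eta>"
begin

interpretation b1: Vector_Spaces.linear "alg_scale B" "alg_scale B" \<beta>1 by (rule \<beta>_linear)
interpretation b2: Vector_Spaces.linear "rep_scale B" "rep_scale B" \<beta>2 by (rule \<beta>_linear)

text \<open>The quotient components agree because \<open>\<alpha>1\<close> preserves brackets. The
  kernel components give one equation in \<open>x\<close>, \<open>y\<close>, \<open>a\<close>,
  \<open>b\<close>, which splits according to its dependence on the kernel variables; the part in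
  both \<open>a\<close> and \<open>b\<close> holds because \<open>\<beta>1\<close> preserves
  brackets.\<close>

lemma lift_bracket_iff:
  "(\<forall>e f. alg.lift \<alpha>1 \<beta>1 \<zeta> (bracket E e f) =
      bracket E (alg.lift \<alpha>1 \<beta>1 \<zeta> e) (alg.lift \<alpha>1 \<beta>1 \<zeta> f)) \<longleftrightarrow>
    (\<forall>x y. \<beta>1 (\<omega> x y) - \<omega> (\<alpha>1 x) (\<alpha>1 y) =
      \<rho>B (\<alpha>1 x) (\<zeta> y) - \<rho>B (\<alpha>1 y) (\<zeta> x) - \<zeta> (bracket A x y) + bracket B (\<zeta> x) (\<zeta> y)) \<and>
    (\<forall>x a. \<beta>1 (\<rho>B x a) - \<rho>B (\<alpha>1 x) (\<beta>1 a) = bracket B (\<zeta> x) (\<beta>1 a))"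
    (is "?L \<longleftrightarrow> ?R1 \<and> ?R2")
proof -
  have "?L \<longleftrightarrow> (\<forall>x y b a. alg.lift \<alpha>1 \<beta>1 \<zeta> (bracket E (s1 x + i1 a) (s1 y + i1 b)) =
      bracket E (alg.lift \<alpha>1 \<beta>1 \<zeta> (s1 x + i1 a)) (alg.lift \<alpha>1 \<beta>1 \<zeta> (s1 y + i1 b)))"
    by (metis alg.ex_split)
  also have "\<dots> \<longleftrightarrow> (\<forall>x y b a.
      \<zeta> (bracket A x y) + \<beta>1 (\<omega> x y + \<rho>B x b - \<rho>B y a + bracket B a b) =
      \<omega> (\<alpha>1 x) (\<alpha>1 y) + \<rho>B (\<alpha>1 x) (\<zeta> y + \<beta>1 b) - \<rho>B (\<alpha>1 y) (\<zeta> x + \<beta>1 a)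
        + bracket B (\<zeta> x + \<beta>1 a) (\<zeta> y + \<beta>1 b))" (is "_ \<longleftrightarrow> ?M")
    by (simp add: bracket_split \<alpha>_hom)
  also have "?M \<longleftrightarrow> ?R1 \<and> ?R2"
  proof
    assume M: ?M
    have ?R1
    proof (intro allI)
      fix x y
      show "\<beta>1 (\<omega> x y) - \<omega> (\<alpha>1 x) (\<alpha>1 y) =
        \<rho>B (\<alpha>1 x) (\<zeta> y) - \<rho>B (\<alpha>1 y) (\<zeta> x) - \<zeta> (bracket A x y) + bracket B (\<zeta> x) (\<zeta> y)"
        \<comment> \<open>With both kernel variables zero only the \<open>\<omega>\<close> and
          \<open>\<zeta>\<close> terms survive.\<close>
        using M[rule_format, of x y 0 0]
        by (simp add: \<rho>B_zero b1.zero B.br_left.zero algebra_simps)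
    qed
    moreover have ?R2
    proof (intro allI)
      fix x a
      show "\<beta>1 (\<rho>B x a) - \<rho>B (\<alpha>1 x) (\<beta>1 a) = bracket B (\<zeta> x) (\<beta>1 a)"
        \<comment> \<open>Subtracting the instance with kernel variable \<open>0\<close> from the
          one with \<open>a\<close> cancels all terms free of \<open>a\<close>, including those in
          \<open>\<omega>\<close>.\<close>
        using arg_cong2[where f = minus,
            OF M[rule_format, of x 0 a 0] M[rule_format, of x 0 0 0]]
        by (simp add: \<rho>B_zero \<rho>B_add b1.zero b1.add B.br_left.zero B.br_right.add algebra_simps)
    qed
    ultimately show "?R1 \<and> ?R2" ..
  next
    assume R: "?R1 \<and> ?R2"
    have "\<beta>1 (\<omega> x y) = \<omega> (\<alpha>1 x) (\<alpha>1 y) + \<rho>B (\<alpha>1 x) (\<zeta> y) - \<rho>B (\<alpha>1 y) (\<zeta> x)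
        - \<zeta> (bracket A x y) + bracket B (\<zeta> x) (\<zeta> y)"
      and "\<beta>1 (\<rho>B x a) = \<rho>B (\<alpha>1 x) (\<beta>1 a) + bracket B (\<zeta> x) (\<beta>1 a)" for x y a
      using R by (simp_all add: algebra_simps)
    \<comment> \<open>The kernel element may also stand in the first slot; antisymmetry lets the
      second identity cover that case too.\<close>
    moreover have "bracket B (\<beta>1 a) (\<zeta> y) = - bracket B (\<zeta> y) (\<beta>1 a)" for y a
      by (rule B.br_antisym)
    ultimately show ?M
      by (simp add: \<rho>B_add b1.add b1.diff \<beta>_hom B.br_left.add B.br_right.add)
  qed
  finally show ?thesis .
qed

text \<open>The same separation of variables. The two arguments of the action play different roles,
  so the terms in \<open>m\<close> alone and in \<open>a\<close> alone yield separate identities,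
  for \<open>\<rho>M\<close> and for \<open>\<mu>\<close>.\<close>

lemma lift_action_iff:
  "(\<forall>e w. rep.lift \<alpha>2 \<beta>2 \<eta> (action E e w) =
      action E (alg.lift \<alpha>1 \<beta>1 \<zeta> e) (rep.lift \<alpha>2 \<beta>2 \<eta> w)) \<longleftrightarrow>
    (\<forall>x m. \<beta>2 (\<rho>M x m) - \<rho>M (\<alpha>1 x) (\<beta>2 m) = action B (\<zeta> x) (\<beta>2 m)) \<and>
    (\<forall>v a. \<beta>2 (\<mu> v a) - \<mu> (\<alpha>2 v) (\<beta>1 a) = - action B (\<beta>1 a) (\<eta> v)) \<and>
    (\<forall>x v. \<beta>2 (\<omega>' x v) - \<omega>' (\<alpha>1 x) (\<alpha>2 v) =
      action B (\<zeta> x) (\<eta> v) - \<mu> (\<alpha>2 v) (\<zeta> x) + \<rho>M (\<alpha>1 x) (\<eta> v) - \<eta> (action A x v))"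
    (is "?L \<longleftrightarrow> ?R1 \<and> ?R2 \<and> ?R3")
proof -
  have "?L \<longleftrightarrow> (\<forall>x v m a. rep.lift \<alpha>2 \<beta>2 \<eta> (action E (s1 x + i1 a) (s2 v + i2 m)) =
      action E (alg.lift \<alpha>1 \<beta>1 \<zeta> (s1 x + i1 a)) (rep.lift \<alpha>2 \<beta>2 \<eta> (s2 v + i2 m)))"
    by (metis alg.ex_split rep.ex_split)
  also have "\<dots> \<longleftrightarrow> (\<forall>x v m a.
      \<eta> (action A x v) + \<beta>2 (\<omega>' x v + \<rho>M x m - \<mu> v a + action B a m) =
      \<omega>' (\<alpha>1 x) (\<alpha>2 v) + \<rho>M (\<alpha>1 x) (\<eta> v + \<beta>2 m) - \<mu> (\<alpha>2 v) (\<zeta> x + \<beta>1 a)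
        + action B (\<zeta> x + \<beta>1 a) (\<eta> v + \<beta>2 m))" (is "_ \<longleftrightarrow> ?M")
    by (simp add: action_split \<alpha>_hom)
  also have "?M \<longleftrightarrow> ?R1 \<and> ?R2 \<and> ?R3"
  proof
    assume M: ?M
    have ?R3
    proof (intro allI)
      fix x v
      show "\<beta>2 (\<omega>' x v) - \<omega>' (\<alpha>1 x) (\<alpha>2 v) =
        action B (\<zeta> x) (\<eta> v) - \<mu> (\<alpha>2 v) (\<zeta> x) + \<rho>M (\<alpha>1 x) (\<eta> v) - \<eta> (action A x v)"
        using M[rule_format, of x v 0 0]
        by (simp add: \<rho>M_zero \<mu>_zero b1.zero b2.zero B.rho_left.zero algebra_simps)
    qed
    moreover have ?R1
    proof (intro allI)
      fix x m
      show "\<beta>2 (\<rho>M x m) - \<rho>M (\<alpha>1 x) (\<beta>2 m) = action B (\<zeta> x) (\<beta>2 m)"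
        \<comment> \<open>The difference isolates the dependence on \<open>m\<close>; with
          \<open>a = 0\<close> no mixed kernel term appears.\<close>
        using arg_cong2[where f = minus,
            OF M[rule_format, of x 0 m 0] M[rule_format, of x 0 0 0]]
        by (simp add: \<rho>M_zero \<rho>M_add \<mu>_zero b1.zero b2.zero b2.add B.rho_left.zero
            B.rho_right.add algebra_simps)
    qed
    moreover have ?R2
    proof (intro allI)
      fix v a
      show "\<beta>2 (\<mu> v a) - \<mu> (\<alpha>2 v) (\<beta>1 a) = - action B (\<beta>1 a) (\<eta> v)"
        \<comment> \<open>The difference isolates the dependence on \<open>a\<close>, now with
          \<open>m = 0\<close>.\<close>
        using arg_cong2[where f = minus,
            OF M[rule_format, of 0 v 0 a] M[rule_format, of 0 v 0 0]]
        by (simp add: \<rho>M_zero \<mu>_zero \<mu>_add b1.zero b2.zero b2.diff B.rho_left.add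
            B.rho_right.zero algebra_simps)
    qed
    ultimately show "?R1 \<and> ?R2 \<and> ?R3" by blast
  next
    assume R: "?R1 \<and> ?R2 \<and> ?R3"
    have "\<beta>2 (\<rho>M x m) = \<rho>M (\<alpha>1 x) (\<beta>2 m) + action B (\<zeta> x) (\<beta>2 m)"
      and "\<beta>2 (\<mu> v a) = \<mu> (\<alpha>2 v) (\<beta>1 a) - action B (\<beta>1 a) (\<eta> v)"
      and "\<beta>2 (\<omega>' x v) = \<omega>' (\<alpha>1 x) (\<alpha>2 v) + action B (\<zeta> x) (\<eta> v) - \<mu> (\<alpha>2 v) (\<zeta> x)
        + \<rho>M (\<alpha>1 x) (\<eta> v) - \<eta> (action A x v)" for x m v a
      using R by (simp_all add: algebra_simps)
    then show ?M
      by (simp add: \<rho>M_add \<mu>_add b2.add b2.diff \<beta>_hom B.rho_left.add B.rho_right.add)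
  qed
  finally show ?thesis .
qed

text \<open>The kernel coordinate \<open>m\<close> contributes \<open>rb_op B (\<beta>2 m)\<close>
  on one side and \<open>\<beta>1 (rb_op B m)\<close> on the other. These agree, so a condition on
  \<open>v\<close> alone remains.\<close>

lemma lift_rb_op_iff:
  "(\<forall>w. rb_op E (rep.lift \<alpha>2 \<beta>2 \<eta> w) = alg.lift \<alpha>1 \<beta>1 \<zeta> (rb_op E w)) \<longleftrightarrow>
    (\<forall>v. \<beta>1 (\<chi> v) - \<chi> (\<alpha>2 v) = rb_op B (\<eta> v) - \<zeta> (rb_op A v))"
proof -
  have "(\<forall>w. rb_op E (rep.lift \<alpha>2 \<beta>2 \<eta> w) = alg.lift \<alpha>1 \<beta>1 \<zeta> (rb_op E w)) \<longleftrightarrow>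
    (\<forall>v m. rb_op E (rep.lift \<alpha>2 \<beta>2 \<eta> (s2 v + i2 m)) =
      alg.lift \<alpha>1 \<beta>1 \<zeta> (rb_op E (s2 v + i2 m)))"
    by (metis rep.ex_split)
  also have "\<dots> \<longleftrightarrow> (\<forall>v. \<beta>1 (\<chi> v) - \<chi> (\<alpha>2 v) = rb_op B (\<eta> v) - \<zeta> (rb_op A v))"
    by (simp add: rb_op_split \<alpha>_hom \<beta>_hom b1.add TB.add) (auto simp: algebra_simps)
  finally show ?thesis .
qed

lemma lift_hom_iff:
  "rrb_hom E E (alg.lift \<alpha>1 \<beta>1 \<zeta>, rep.lift \<alpha>2 \<beta>2 \<eta>) \<longleftrightarrow>
    (\<forall>x y a v m.
      \<beta>1 (\<omega> x y) - \<omega> (\<alpha>1 x) (\<alpha>1 y) =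
        \<rho>B (\<alpha>1 x) (\<zeta> y) - \<rho>B (\<alpha>1 y) (\<zeta> x) - \<zeta> (bracket A x y) + bracket B (\<zeta> x) (\<zeta> y) \<and>
      \<beta>1 (\<rho>B x a) - \<rho>B (\<alpha>1 x) (\<beta>1 a) = bracket B (\<zeta> x) (\<beta>1 a) \<and>
      \<beta>2 (\<rho>M x m) - \<rho>M (\<alpha>1 x) (\<beta>2 m) = action B (\<zeta> x) (\<beta>2 m) \<and>
      \<beta>2 (\<mu> v a) - \<mu> (\<alpha>2 v) (\<beta>1 a) = - action B (\<beta>1 a) (\<eta> v) \<and>
      \<beta>2 (\<omega>' x v) - \<omega>' (\<alpha>1 x) (\<alpha>2 v) =
        action B (\<zeta> x) (\<eta> v) - \<mu> (\<alpha>2 v) (\<zeta> x) + \<rho>M (\<alpha>1 x) (\<eta> v) - \<eta> (action A x v) \<and>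
      \<beta>1 (\<chi> v) - \<chi> (\<alpha>2 v) = rb_op B (\<eta> v) - \<zeta> (rb_op A v))"
  unfolding rrb_hom_def prod.case lift_bracket_iff lift_action_iff lift_rb_op_iff
  using alg.linear_lift[OF \<alpha>_linear(1) \<beta>_linear(1) \<zeta>]
    rep.linear_lift[OF \<alpha>_linear(2) \<beta>_linear(2) \<eta>]
  by blast

end

end

end

section \<open>The criterion for inducibility\<close>

theorem theorem4p2:
  fixes A :: "('k::field, 'a::ab_group_add, 'v::ab_group_add) rrb_data"
    and B :: "('k, 'b::ab_group_add, 'm::ab_group_add) rrb_data"
    and E :: "('k, 'e::ab_group_add, 'w::ab_group_add) rrb_data"
    and i1 :: "'b \<Rightarrow> 'e" and i2 :: "'m \<Rightarrow> 'w"
    and p1 :: "'e \<Rightarrow> 'a" and p2 :: "'w \<Rightarrow> 'v"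
    and s1 :: "'a \<Rightarrow> 'e" and s2 :: "'v \<Rightarrow> 'w"
    and \<omega> :: "'a \<Rightarrow> 'a \<Rightarrow> 'b" and \<omega>' :: "'a \<Rightarrow> 'v \<Rightarrow> 'm" and \<chi> :: "'v \<Rightarrow> 'b"
    and \<mu> :: "'v \<Rightarrow> 'b \<Rightarrow> 'm" and \<rho>B :: "'a \<Rightarrow> 'b \<Rightarrow> 'b" and \<rho>M :: "'a \<Rightarrow> 'm \<Rightarrow> 'm"
    and \<alpha>1 :: "'a \<Rightarrow> 'a" and \<alpha>2 :: "'v \<Rightarrow> 'v" and \<beta>1 :: "'b \<Rightarrow> 'b" and \<beta>2 :: "'m \<Rightarrow> 'm"
  assumes "rel_rota_baxter_lie A" and "rel_rota_baxter_lie B"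
    and "nonabelian_extension A B E (i1, i2) (p1, p2)"
    and "is_section A E (p1, p2) (s1, s2)"
    and "(\<omega>, \<omega>', \<chi>, \<mu>, \<rho>B, \<rho>M) = induced_cocycle A E (i1, i2) (s1, s2)"
    and "(\<alpha>1, \<alpha>2) \<in> rrb_Aut A" and "(\<beta>1, \<beta>2) \<in> rrb_Aut B"
  shows "inducible E (i1, i2) (p1, p2) (s1, s2) (\<alpha>1, \<alpha>2) (\<beta>1, \<beta>2) \<longleftrightarrow>
    (\<exists>\<zeta> \<eta>. Vector_Spaces.linear (alg_scale A) (alg_scale B) \<zeta> \<and>
      Vector_Spaces.linear (rep_scale A) (rep_scale B) \<eta> \<and>
      (\<forall>x y a v m.
        \<beta>1 (\<omega> x y) - \<omega> (\<alpha>1 x) (\<alpha>1 y) =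
          \<rho>B (\<alpha>1 x) (\<zeta> y) - \<rho>B (\<alpha>1 y) (\<zeta> x) - \<zeta> (bracket A x y) + bracket B (\<zeta> x) (\<zeta> y) \<and>
        \<beta>1 (\<rho>B x a) - \<rho>B (\<alpha>1 x) (\<beta>1 a) = bracket B (\<zeta> x) (\<beta>1 a) \<and>
        \<beta>2 (\<rho>M x m) - \<rho>M (\<alpha>1 x) (\<beta>2 m) = action B (\<zeta> x) (\<beta>2 m) \<and>
        \<beta>2 (\<mu> v a) - \<mu> (\<alpha>2 v) (\<beta>1 a) = - action B (\<beta>1 a) (\<eta> v) \<and>
        \<beta>2 (\<omega>' x v) - \<omega>' (\<alpha>1 x) (\<alpha>2 v) =
          action B (\<zeta> x) (\<eta> v) - \<mu> (\<alpha>2 v) (\<zeta> x) + \<rho>M (\<alpha>1 x) (\<eta> v) - \<eta> (action A x v) \<and>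
        \<beta>1 (\<chi> v) - \<chi> (\<alpha>2 v) = rb_op B (\<eta> v) - \<zeta> (rb_op A v)))"
proof -
  interpret rrb_split_extension A B E i1 i2 p1 p2 s1 s2 \<omega> \<omega>' \<chi> \<mu> \<rho>B \<rho>M
    using assms(3-5) by unfold_locales
  show ?thesis
    unfolding inducible_iff_lift[OF assms(6,7)]
    \<comment> \<open>Both sides are compared under the quantifiers over \<open>\<zeta>\<close> and
      \<open>\<eta>\<close>; \<open>conj_cong\<close> supplies their linearity, which
      \<open>lift_hom_iff\<close> requires.\<close>
    by (intro arg_cong[where f = Ex] ext conj_cong refl)
      (rule lift_hom_iff[OF assms(6,7)])
qed

end
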